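(* Let $G=(V,E)$ be a connected, finite, simple, undirected graph with $N=\#V\geq 2$ vertices which is symmetric. Let $0=\lambda_0<\lambda_1\leq\lambda_2\leq\cdots\leq\lambda_{N-1}$ be all the eigenvalues of the normalized Laplace operator $\Delta$ of $G$, counted with multiplicity. Then for every non-zero eigenvalue $\lambda$ of $\Delta$ and every integer $k$ with $0\leq k\leq N-2$, \[ \sum_{i=0}^k(\lambda_{k+1}-\lambda_i)^2(1-\lambda_i)\leq \sum_{i=0}^k(\lambda_{k+1}-\lambda_i)\bigl(2(2-\lambda)\lambda_i+\lambda\bigr). \]
   Context: A graph $G=(V,E)$ is symmetric if for any two edges $(x,y),(x',y')$ (as ordered pairs of adjacent vertices) there is a graph automorphism $\gamma$ of $G$ with $\gamma x=x'$ and $\gamma y=y'$. A symmetric graph is vertex-transitive, hence $d$-regular for some $d\geq 1$. Write $x\sim y$ when $x,y$ are adjacent. For a $d$-regular graph, the normalized Laplace operator acts on real functions $u:V\to\mathbb{R}$ by $\Delta u(x)=\frac1d\sum_{y\sim x}(u(y)-u(x))$. A number $\lambda$ is an eigenvalue of $\Delta$ if $\Delta u+\lambda u=0$ for some non-zero $u$; multiplicity is the dimension of the space of such $u$. *)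

theory Defs
  imports
    Complex_Main
    "HOL-Library.Function_Algebras"
    "Graph_Theory.Graph_Theory"
begin

text \<open>
  Finite simple undirected graphs are \<^locale>\<open>pair_graph\<close>s: finite, loop-free, and each
  undirected edge is stored as its two ordered pairs \<open>(x, y)\<close>, \<open>(y, x)\<close> in \<open>parcs G\<close>.
\<close>

definition graph_automorphism :: "'v pair_pre_digraph \<Rightarrow> ('v \<Rightarrow> 'v) \<Rightarrow> bool" where
  "graph_automorphism G \<gamma> \<longleftrightarrow>
     bij_betw \<gamma> (pverts G) (pverts G) \<and>
     (\<forall>x\<in>pverts G. \<forall>y\<in>pverts G. (x, y) \<in> parcs G \<longleftrightarrow> (\<gamma> x, \<gamma> y) \<in> parcs G)"

text \<open>
  Symmetric graphs in the sense of algebraic graph theory, also called arc-transitive. (The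
  constant \<^const>\<open>symmetric\<close> is something else: it states that the arc relation is symmetric.)
\<close>

definition arc_transitive :: "'v pair_pre_digraph \<Rightarrow> bool" where
  "arc_transitive G \<longleftrightarrow>
     (\<forall>x y x' y'. (x, y) \<in> parcs G \<longrightarrow> (x', y') \<in> parcs G \<longrightarrow>
        (\<exists>\<gamma>. graph_automorphism G \<gamma> \<and> \<gamma> x = x' \<and> \<gamma> y = y'))"

text \<open>
  The number \<open>d\<close> of the normalisation is the degree of \<open>x\<close>, which does not depend on \<open>x\<close> in a
  regular graph.
\<close>

definition laplacian :: "'v pair_pre_digraph \<Rightarrow> ('v \<Rightarrow> real) \<Rightarrow> 'v \<Rightarrow> real" where
  "laplacian G u x =
     1 / real (out_degree (with_proj G) x) * (\<Sum>y | (x, y) \<in> parcs G. u y - u x)"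

definition fun_scale :: "real \<Rightarrow> ('v \<Rightarrow> real) \<Rightarrow> 'v \<Rightarrow> real" where
  "fun_scale c u = (\<lambda>x. c * u x)"

interpretation fun_space: vector_space "fun_scale :: real \<Rightarrow> ('v \<Rightarrow> real) \<Rightarrow> 'v \<Rightarrow> real"
  by unfold_locales (auto simp: fun_scale_def fun_eq_iff algebra_simps)

text \<open>
  A function \<open>V \<rightarrow> \<real>\<close> is represented by its extension to the whole type by zero, so that functions
  on \<open>V\<close> form a linear subspace and equality of functions is equality on \<open>V\<close>.
\<close>

definition eigenspace :: "'v pair_pre_digraph \<Rightarrow> real \<Rightarrow> ('v \<Rightarrow> real) set" where
  "eigenspace G \<mu> =
     {u. (\<forall>x. x \<notin> pverts G \<longrightarrow> u x = 0) \<and>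
         (\<forall>x\<in>pverts G. laplacian G u x + \<mu> * u x = 0)}"

definition is_eigenvalue :: "'v pair_pre_digraph \<Rightarrow> real \<Rightarrow> bool" where
  "is_eigenvalue G \<mu> \<longleftrightarrow> (\<exists>u\<in>eigenspace G \<mu>. u \<noteq> 0)"

definition multiplicity_of :: "'v pair_pre_digraph \<Rightarrow> real \<Rightarrow> nat" where
  "multiplicity_of G \<mu> = fun_space.dim (eigenspace G \<mu>)"

text \<open>
  \<open>lam 0 \<le> \<dots> \<le> lam (N - 1)\<close> lists all eigenvalues with multiplicity: every real \<open>\<mu>\<close> occurs exactly
  as often as the dimension of its eigenspace (so not at all if it is no eigenvalue). Values of
  \<open>lam\<close> at indices \<open>\<ge> N\<close> are irrelevant.
\<close>

definition laplace_spectrum :: "'v pair_pre_digraph \<Rightarrow> (nat \<Rightarrow> real) \<Rightarrow> bool" where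
  "laplace_spectrum G lam \<longleftrightarrow>
     mono_on {..<card (pverts G)} lam \<and>
     (\<forall>\<mu>. card {i. i < card (pverts G) \<and> lam i = \<mu>} = multiplicity_of G \<mu>)"

end

theory Submission
  imports Defs "HOL-Combinatorics.Permutations" "HOL-Analysis.Convex"
begin

text \<open>
  Let \<open>u\<^sub>i\<close> be orthonormal eigenfunctions, \<open>g\<close> any function, \<open>z = \<lambda>\<^sub>k\<^sub>+\<^sub>1\<close> and
  \<open>a\<^sub>i\<^sub>j = \<langle>g u\<^sub>i, u\<^sub>j\<rangle>\<close>. The commutator of \<open>- \<Delta>\<close> with multiplication by \<open>g\<close> has matrix entries
  \<open>(\<lambda>\<^sub>j - \<lambda>\<^sub>i) a\<^sub>i\<^sub>j\<close>, and
  \<open>\<Sum>\<^sub>i\<^sub>\<le>\<^sub>k \<Sum>\<^sub>j (z - \<lambda>\<^sub>i) (\<lambda>\<^sub>j - \<lambda>\<^sub>i) (z - \<lambda>\<^sub>j) a\<^sub>i\<^sub>j\<^sup>2 \<le> 0\<close>,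
  because the part with \<open>j \<le> k\<close> vanishes by antisymmetry and the terms with \<open>j > k\<close> are \<open>\<le> 0\<close>.
  Apply this to \<open>g = h \<circ> \<gamma>\<close> for an eigenfunction \<open>h\<close> of the given eigenvalue and sum over all
  automorphisms \<open>\<gamma>\<close>: by arc-transitivity \<open>\<Sum>\<^sub>\<gamma> h(\<gamma> x) h(\<gamma> y)\<close> is one constant on the diagonal
  and \<open>1 - \<mu>\<close> times that constant on all arcs, which evaluates one side exactly and bounds
  the other by Cauchy-Schwarz.
\<close>

section \<open>Inner products, commutator sums and orthonormal systems\<close>

definition inner_on :: "'a set \<Rightarrow> ('a \<Rightarrow> real) \<Rightarrow> ('a \<Rightarrow> real) \<Rightarrow> real" where
  "inner_on V u v = (\<Sum>x\<in>V. u x * v x)"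

lemma inner_on_commute: "inner_on V u v = inner_on V v u"
  by (simp add: inner_on_def mult.commute)

lemma sum_mult_delta:
  fixes f :: "'a \<Rightarrow> real"
  assumes "finite I" "a \<in> I"
  shows "(\<Sum>j\<in>I. f j * (if a = j then 1 else 0)) = f a"
proof -
  have "(\<Sum>j\<in>I. f j * (if a = j then 1 else 0)) = (\<Sum>j\<in>I. if a = j then f j else 0)"
    by (rule sum.cong) auto
  then show ?thesis using assms by simp
qed

lemma commutator_sum_inequality:
  fixes a :: "nat \<Rightarrow> nat \<Rightarrow> real"
  assumes sym: "\<And>i j. a i j = a j i"
    and mono: "mono_on {..<N} lam"
    and k: "k + 1 < N"
  defines "z \<equiv> lam (k + 1)"
  shows "(\<Sum>i=0..k. (z - lam i)^2 * (\<Sum>j<N. (lam j - lam i) * (a i j)^2))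
       \<le> (\<Sum>i=0..k. (z - lam i) * (\<Sum>j<N. (lam j - lam i)^2 * (a i j)^2))"
proof -
  \<comment> \<open>The difference of the summands of the two sides, since
    \<open>(z - lam i) - (lam j - lam i) = z - lam j\<close>.\<close>
  define F where "F i j = (z - lam i) * (lam j - lam i) * (z - lam j) * (a i j)^2" for i j
  have diff: "(\<Sum>i=0..k. (z - lam i)^2 * (\<Sum>j<N. (lam j - lam i) * (a i j)^2))
       - (\<Sum>i=0..k. (z - lam i) * (\<Sum>j<N. (lam j - lam i)^2 * (a i j)^2))
      = (\<Sum>i=0..k. \<Sum>j<N. F i j)"
    unfolding sum_subtractf[symmetric] sum_distrib_left F_def
    by (intro sum.cong refl) (simp add: algebra_simps power2_eq_square)
  have split: "{..<N} = {0..k} \<union> {k+1..<N}" using k by auto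
  have "(\<Sum>i=0..k. \<Sum>j<N. F i j) = (\<Sum>i=0..k. \<Sum>j=0..k. F i j) + (\<Sum>i=0..k. \<Sum>j=k+1..<N. F i j)"
    unfolding split sum.distrib[symmetric]
    by (intro sum.cong refl sum.union_disjoint) auto
  moreover have "(\<Sum>i=0..k. \<Sum>j=0..k. F i j) = 0"
  proof -
    have "(\<Sum>i=0..k. \<Sum>j=0..k. F i j) = (\<Sum>i=0..k. \<Sum>j=0..k. F j i)"
      by (rule sum.swap)
    \<comment> \<open>Exchanging \<open>i\<close> and \<open>j\<close> changes only the sign of the
      factor \<open>lam j - lam i\<close>.\<close>
    also have "\<dots> = (\<Sum>i=0..k. \<Sum>j=0..k. - F i j)"
      unfolding F_def by (intro sum.cong refl) (simp add: sym algebra_simps)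
    finally show ?thesis by (simp add: sum_negf)
  qed
  moreover have "(\<Sum>i=0..k. \<Sum>j=k+1..<N. F i j) \<le> 0"
  proof (intro sum_nonpos)
    fix i j assume "i \<in> {0..k}" "j \<in> {k+1..<N}"
    then have "lam i \<le> z" "z \<le> lam j" "lam i \<le> lam j"
      using k unfolding z_def by (auto intro!: mono_onD[OF mono])
    then have "(z - lam i) * (lam j - lam i) \<ge> 0" "z - lam j \<le> 0" by simp_all
    then show "F i j \<le> 0"
      unfolding F_def by (simp add: mult_nonneg_nonpos mult_nonpos_nonneg)
  qed
  ultimately show ?thesis using diff by simp
qed

text \<open>
  Bessel's inequality for the point mass at \<open>x\<close> reads \<open>\<Sum>\<^sub>i u\<^sub>i(x)\<^sup>2 \<le> 1\<close>; summed over \<open>x\<close> both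
  sides are equal, so every point mass lies in the span.
\<close>
lemma orthonormal_completeness:
  fixes u :: "nat \<Rightarrow> 'a \<Rightarrow> real"
  assumes V: "finite V"
    and on: "\<And>i j. i < card V \<Longrightarrow> j < card V \<Longrightarrow> inner_on V (u i) (u j) = (if i = j then 1 else 0)"
    and xy: "x \<in> V" "y \<in> V"
  shows "(\<Sum>i<card V. u i x * u i y) = (if x = y then 1 else 0)"
proof -
  define K where "K x y = (\<Sum>i<card V. u i x * u i y)" for x y
  \<comment> \<open>\<open>K\<close> is the kernel of the orthogonal projection onto the span of the
    \<open>u i\<close>, hence symmetric and idempotent.\<close>
  have KK: "(\<Sum>y\<in>V. K x y * K x y) = K x x" for x
  proof -
    have "(\<Sum>y\<in>V. K x y * K x y)
      = (\<Sum>y\<in>V. \<Sum>i<card V. \<Sum>j<card V. u i x * u j x * (u i y * u j y))"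
      unfolding K_def sum_product by (intro sum.cong refl) (simp add: algebra_simps)
    also have "\<dots> = (\<Sum>i<card V. \<Sum>j<card V. \<Sum>y\<in>V. u i x * u j x * (u i y * u j y))"
      by (subst sum.swap, intro sum.cong refl, rule sum.swap)
    also have "\<dots> = (\<Sum>i<card V. \<Sum>j<card V. u i x * u j x * (if i = j then 1 else 0))"
      by (intro sum.cong refl) (simp add: sum_distrib_left[symmetric] on[symmetric] inner_on_def)
    also have "\<dots> = K x x"
      unfolding K_def by (intro sum.cong refl, subst sum_mult_delta) auto
    finally show ?thesis .
  qed
  have bessel: "(\<Sum>y\<in>V. ((if x = y then 1 else 0) - K x y)^2) = 1 - K x x" if "x \<in> V" for x
  proof -
    have "(\<Sum>y\<in>V. ((if x = y then 1 else 0) - K x y)^2)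
      = (\<Sum>y\<in>V. (1 - 2 * K x y) * (if x = y then 1 else 0) + K x y * K x y)"
      by (intro sum.cong refl) (auto simp: power2_eq_square algebra_simps)
    then show ?thesis
      unfolding sum.distrib KK using V that by (subst (asm) sum_mult_delta) auto
  qed
  have "(\<Sum>x\<in>V. K x x) = (\<Sum>i<card V. inner_on V (u i) (u i))"
    unfolding K_def inner_on_def by (rule sum.swap)
  also have "\<dots> = card V" by (simp add: on)
  finally have "(\<Sum>x\<in>V. 1 - K x x) = 0" by (simp add: sum_subtractf)
  moreover have "1 - K x x \<ge> 0" if "x \<in> V" for x
    unfolding bessel[OF that, symmetric] by (intro sum_nonneg) auto
  ultimately have "1 - K x x = 0"
    using sum_nonneg_eq_0_iff[OF V, of "\<lambda>x. 1 - K x x"] xy by blast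
  \<comment> \<open>The defect \<open>1 - K x x\<close> is the squared distance from the point mass
    at \<open>x\<close> to its projection, so its vanishing determines the off-diagonal entries as
    well.\<close>
  then have "(\<Sum>y\<in>V. ((if x = y then 1 else 0) - K x y)^2) = 0"
    using bessel xy by simp
  then have "((if x = y then 1 else 0) - K x y)^2 = 0"
    using sum_nonneg_eq_0_iff[OF V, of "\<lambda>y. ((if x = y then 1 else 0) - K x y)^2"] xy by auto
  then show ?thesis unfolding K_def by simp
qed

text \<open>Exchanging the sums places the kernel of \<open>orthonormal_completeness\<close> between
  \<open>f\<close> and \<open>g\<close>, where it acts as the identity.\<close>

lemma orthonormal_parseval:
  fixes u :: "nat \<Rightarrow> 'a \<Rightarrow> real"
  assumes V: "finite V"
    and on: "\<And>i j. i < card V \<Longrightarrow> j < card V \<Longrightarrow> inner_on V (u i) (u j) = (if i = j then 1 else 0)"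
  shows "inner_on V f g = (\<Sum>j<card V. inner_on V f (u j) * inner_on V g (u j))"
proof -
  have "(\<Sum>j<card V. inner_on V f (u j) * inner_on V g (u j))
     = (\<Sum>j<card V. \<Sum>x\<in>V. \<Sum>y\<in>V. f x * g y * (u j x * u j y))"
    unfolding inner_on_def sum_product by (intro sum.cong refl) (simp add: algebra_simps)
  also have "\<dots> = (\<Sum>x\<in>V. \<Sum>y\<in>V. \<Sum>j<card V. f x * g y * (u j x * u j y))"
    by (subst sum.swap, intro sum.cong refl, rule sum.swap)
  also have "\<dots> = (\<Sum>x\<in>V. \<Sum>y\<in>V. f x * g y * (if x = y then 1 else 0))"
    by (intro sum.cong refl)
      (simp add: sum_distrib_left[symmetric] orthonormal_completeness[OF V on])
  also have "\<dots> = inner_on V f g"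
    unfolding inner_on_def using V by (intro sum.cong refl, subst sum_mult_delta) auto
  finally show ?thesis by simp
qed

lemma sum_fun_scale_apply: "(\<Sum>b\<in>B. fun_scale (c b) b) x = (\<Sum>b\<in>B. c b * b x)"
  by (induction B rule: infinite_finite_induct) (auto simp: fun_scale_def)

text \<open>Gram-Schmidt, one vector at a time: fewer than \<open>dim E\<close> vectors cannot span
  \<open>E\<close>, so some \<open>v\<close> in \<open>E\<close> has a non-zero component
  \<open>w\<close> orthogonal to those already chosen.\<close>

lemma orthonormal_set_in_subspace:
  fixes E :: "('a \<Rightarrow> real) set"
  assumes V: "finite V" and sub: "fun_space.subspace E"
    and supp: "\<And>u x. u \<in> E \<Longrightarrow> x \<notin> V \<Longrightarrow> u x = 0"
    and n: "n \<le> fun_space.dim E"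
  shows "\<exists>B\<subseteq>E. finite B \<and> card B = n \<and>
           (\<forall>b\<in>B. \<forall>c\<in>B. inner_on V b c = (if b = c then 1 else 0))"
  using n
proof (induction n)
  case 0
  show ?case by (rule exI[of _ "{}"]) auto
next
  case (Suc n)
  then obtain B where B: "B \<subseteq> E" "finite B" "card B = n"
    and on: "\<forall>b\<in>B. \<forall>c\<in>B. inner_on V b c = (if b = c then 1 else 0)" by auto
  have "\<not> E \<subseteq> fun_space.span B"
    using fun_space.dim_le_card[of E B] B Suc.prems by auto
  then obtain v where v: "v \<in> E" "v \<notin> fun_space.span B" by auto
  define p where "p = (\<Sum>b\<in>B. fun_scale (inner_on V v b) b)"
  define w where "w = v - p"
  have p_span: "p \<in> fun_space.span B"
    unfolding p_def by (intro fun_space.span_sum fun_space.span_scale fun_space.span_base)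
  have "p \<in> E"
    unfolding p_def using B by (intro fun_space.subspace_sum[OF sub] fun_space.subspace_scale[OF sub]) auto
  then have wE: "w \<in> E"
    unfolding w_def using fun_space.subspace_diff[OF sub] v by blast
  have "w \<noteq> 0" using v p_span unfolding w_def by auto
  then obtain x0 where x0: "w x0 \<noteq> 0" by (auto simp: fun_eq_iff)
  \<comment> \<open>Vanishing outside \<open>V\<close> makes the form \<open>inner_on V\<close>
    positive definite on \<open>E\<close>.\<close>
  then have "x0 \<in> V" using supp[OF wE] by blast
  then have wpos: "inner_on V w w > 0"
    unfolding inner_on_def using x0 V
    by (intro sum_pos2[of V x0]) (auto simp: zero_less_mult_iff linorder_neq_iff)
  have worth: "inner_on V w c = 0" if c: "c \<in> B" for c
  proof -
    have "inner_on V p c = (\<Sum>x\<in>V. \<Sum>b\<in>B. inner_on V v b * (c x * b x))"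
      unfolding inner_on_def[of V p] unfolding p_def sum_fun_scale_apply
      by (simp add: sum_distrib_left ac_simps)
    also have "\<dots> = (\<Sum>b\<in>B. inner_on V v b * inner_on V c b)"
      by (subst sum.swap) (simp add: sum_distrib_left[symmetric] inner_on_def[of V c])
    also have "\<dots> = (\<Sum>b\<in>B. inner_on V v b * (if c = b then 1 else 0))"
      by (intro sum.cong refl) (use on c in auto)
    also have "\<dots> = inner_on V v c" using sum_mult_delta[of B c] B c by auto
    finally show ?thesis
      unfolding w_def by (simp add: inner_on_def left_diff_distrib sum_subtractf)
  qed
  define e where "e = fun_scale (1 / sqrt (inner_on V w w)) w"
  have eE: "e \<in> E" unfolding e_def by (rule fun_space.subspace_scale[OF sub wE])
  have einner: "inner_on V e c = 1 / sqrt (inner_on V w w) * inner_on V w c" for c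
    unfolding e_def by (simp add: inner_on_def fun_scale_def sum_divide_distrib)
  have ee: "inner_on V e e = 1"
    using wpos unfolding einner inner_on_commute[of V w e]
    by (simp add: field_simps)
  have eorth: "inner_on V e c = 0" "inner_on V c e = 0" if "c \<in> B" for c
    using worth[OF that] einner[of c] by (simp_all add: inner_on_commute[of V c e])
  have "e \<notin> B" using ee eorth by force
  then show ?case
    using B on eE ee eorth by (intro exI[of _ "insert e B"]) auto
qed

section \<open>Eigenfunctions and commutators on a regular graph\<close>

locale regular_relation =
  fixes V :: "'a set" and E :: "('a \<times> 'a) set" and d :: real
  assumes finV: "finite V"
    and arcs: "E \<subseteq> V \<times> V"
    and symE: "(x, y) \<in> E \<Longrightarrow> (y, x) \<in> E"
    and deg: "x \<in> V \<Longrightarrow> real (card {y. (x, y) \<in> E}) = d"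
    and dpos: "d > 0"
begin

abbreviation nb :: "'a \<Rightarrow> 'a set" where "nb x \<equiv> {y. (x, y) \<in> E}"

lemma nb_subset: "nb x \<subseteq> V" using arcs by auto

text \<open>The equation \<open>\<Delta>u + \<mu>u = 0\<close> multiplied by \<open>d\<close> and
  solved for the neighbour sum. Values outside \<open>V\<close> are unconstrained here.\<close>

definition eigf :: "real \<Rightarrow> ('a \<Rightarrow> real) \<Rightarrow> bool" where
  "eigf \<mu> u \<longleftrightarrow> (\<forall>x\<in>V. (\<Sum>y\<in>nb x. u y) = d * (1 - \<mu>) * u x)"

lemma eigfD: "eigf \<mu> u \<Longrightarrow> x \<in> V \<Longrightarrow> (\<Sum>y\<in>nb x. u y) = d * (1 - \<mu>) * u x"
  by (auto simp: eigf_def)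

text \<open>Reversing arcs permutes \<open>E\<close>. This is the source of the self-adjointness of
  the Laplacian.\<close>

lemma sum_arcs_swap:
  fixes F :: "'a \<Rightarrow> 'a \<Rightarrow> real"
  shows "(\<Sum>x\<in>V. \<Sum>y\<in>nb x. F x y) = (\<Sum>x\<in>V. \<Sum>y\<in>nb x. F y x)"
proof -
  \<comment> \<open>An indicator replaces the dependent range \<open>nb x\<close> by the fixed range
    \<open>V\<close>, so that the sums can be exchanged.\<close>
  have *: "(\<Sum>x\<in>V. \<Sum>y\<in>nb x. G x y) = (\<Sum>x\<in>V. \<Sum>y\<in>V. if (x, y) \<in> E then G x y else 0)"
    for G :: "'a \<Rightarrow> 'a \<Rightarrow> real"
  proof (rule sum.cong[OF refl])
    fix x
    have "nb x = {y \<in> V. (x, y) \<in> E}" using arcs by auto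
    then show "(\<Sum>y\<in>nb x. G x y) = (\<Sum>y\<in>V. if (x, y) \<in> E then G x y else 0)"
      using finV by (simp add: sum.inter_filter)
  qed
  show ?thesis unfolding *
    by (subst sum.swap) (intro sum.cong refl if_cong, use symE in blast)
qed

lemma sum_arcs_eigf:
  assumes "eigf \<mu> u"
  shows "(\<Sum>x\<in>V. \<Sum>y\<in>nb x. f x * u y) = d * (1 - \<mu>) * inner_on V f u"
  unfolding inner_on_def sum_distrib_left
  by (intro sum.cong refl)
    (simp add: sum_distrib_left[symmetric] eigfD[OF assms])

text \<open>The form that \<open>eigenspace\<close> takes for a relation; fixing the values outside
  \<open>V\<close> makes its dimension the multiplicity.\<close>

definition supported_eigf :: "real \<Rightarrow> ('a \<Rightarrow> real) set" where
  "supported_eigf \<mu> = {u. (\<forall>x. x \<notin> V \<longrightarrow> u x = 0) \<and> eigf \<mu> u}"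

lemma subspace_supported_eigf: "fun_space.subspace (supported_eigf \<mu>)"
  unfolding fun_space.subspace_def supported_eigf_def eigf_def
  by (auto simp: fun_scale_def sum.distrib distrib_left sum_distrib_left[symmetric])

text \<open>\<open>comm g\<close> is \<open>d\<close> times the commutator of \<open>- \<Delta>\<close> with multiplication by \<open>g\<close>.\<close>
definition comm :: "('a \<Rightarrow> real) \<Rightarrow> ('a \<Rightarrow> real) \<Rightarrow> 'a \<Rightarrow> real" where
  "comm g u x = (\<Sum>y\<in>nb x. (g x - g y) * u y)"

text \<open>In one term of the commutator the Laplacian acts on \<open>u\<close> and yields
  \<open>\<mu>\<close>; in the other it is moved over to \<open>v\<close> by self-adjointness and
  yields \<open>\<nu>\<close>.\<close>

lemma inner_comm:
  assumes u: "eigf \<mu> u" and v: "eigf \<nu> v"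
  shows "inner_on V (comm g u) v = d * (\<nu> - \<mu>) * inner_on V (\<lambda>x. g x * u x) v"
proof -
  have "inner_on V (comm g u) v
      = (\<Sum>x\<in>V. \<Sum>y\<in>nb x. (g x * v x) * u y) - (\<Sum>x\<in>V. \<Sum>y\<in>nb x. v x * (g y * u y))"
    unfolding inner_on_def comm_def sum_subtractf[symmetric] sum_distrib_right
    by (intro sum.cong refl) (simp add: algebra_simps)
  also have "(\<Sum>x\<in>V. \<Sum>y\<in>nb x. v x * (g y * u y)) = (\<Sum>x\<in>V. \<Sum>y\<in>nb x. (g x * u x) * v y)"
    by (subst sum_arcs_swap) (simp add: mult.commute)
  finally have "inner_on V (comm g u) v
      = d * (1 - \<mu>) * inner_on V (\<lambda>x. g x * v x) u - d * (1 - \<nu>) * inner_on V (\<lambda>x. g x * u x) v"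
    unfolding sum_arcs_eigf[OF u] sum_arcs_eigf[OF v] .
  moreover have "inner_on V (\<lambda>x. g x * v x) u = inner_on V (\<lambda>x. g x * u x) v"
    unfolding inner_on_def by (simp add: ac_simps)
  ultimately show ?thesis by (simp add: algebra_simps)
qed

lemma eigf_orthogonal:
  assumes u: "eigf \<mu> u" and v: "eigf \<nu> v" and "\<mu> \<noteq> \<nu>"
  shows "inner_on V u v = 0"
  \<comment> \<open>The commutator with a constant function is zero.\<close>
  using inner_comm[OF u v, of "\<lambda>_. 1"] dpos assms(3) by (simp add: comm_def inner_on_def)

text \<open>Green's formula: expanding the square gives \<open>d + d - 2 * d * (1 - \<mu>)\<close>
  times the squared norm. Each edge is counted in both directions.\<close>

lemma dirichlet_energy:
  assumes u: "eigf \<mu> u"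
  shows "(\<Sum>x\<in>V. \<Sum>y\<in>nb x. (u y - u x)^2) = 2 * d * \<mu> * inner_on V u u"
proof -
  have "(\<Sum>x\<in>V. \<Sum>y\<in>nb x. (u y - u x)^2)
      = (\<Sum>x\<in>V. \<Sum>y\<in>nb x. (u y)^2) + (\<Sum>x\<in>V. \<Sum>y\<in>nb x. (u x)^2) - 2 * (\<Sum>x\<in>V. \<Sum>y\<in>nb x. u x * u y)"
    unfolding sum.distrib[symmetric] sum_subtractf[symmetric] sum_distrib_left
    by (intro sum.cong refl) (simp add: algebra_simps power2_eq_square)
  also have "(\<Sum>x\<in>V. \<Sum>y\<in>nb x. (u y)^2) = (\<Sum>x\<in>V. \<Sum>y\<in>nb x. (u x)^2)"
    by (rule sum_arcs_swap)
  also have "(\<Sum>x\<in>V. \<Sum>y\<in>nb x. (u x)^2) = d * inner_on V u u"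
    unfolding inner_on_def sum_distrib_left
    by (intro sum.cong refl) (simp add: deg power2_eq_square)
  finally show ?thesis unfolding sum_arcs_eigf[OF u] by (simp add: algebra_simps)
qed

lemma eigenvalue_nonneg:
  assumes u: "eigf \<mu> u" and "x \<in> V" "u x \<noteq> 0"
  shows "\<mu> \<ge> 0"
proof -
  have "inner_on V u u > 0"
    unfolding inner_on_def using assms finV
    by (intro sum_pos2[of V x]) (auto simp: zero_less_mult_iff linorder_neq_iff)
  moreover have "2 * d * \<mu> * inner_on V u u \<ge> 0"
    unfolding dirichlet_energy[OF u, symmetric] by (intro sum_nonneg) auto
  ultimately show ?thesis using dpos by (simp add: zero_le_mult_iff)
qed

text \<open>Parseval turns both sides into the sums of
  \<open>commutator_sum_inequality\<close>.\<close>

lemma commutator_inequality: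
  fixes u :: "nat \<Rightarrow> 'a \<Rightarrow> real"
  assumes mono: "mono_on {..<card V} lam" and k: "k + 1 < card V"
    and eig: "\<And>i. i < card V \<Longrightarrow> eigf (lam i) (u i)"
    and on: "\<And>i j. i < card V \<Longrightarrow> j < card V \<Longrightarrow> inner_on V (u i) (u j) = (if i = j then 1 else 0)"
  shows "(\<Sum>i=0..k. (lam (k+1) - lam i)^2 * (d * inner_on V (comm g (u i)) (\<lambda>x. g x * u i x)))
       \<le> (\<Sum>i=0..k. (lam (k+1) - lam i) * inner_on V (comm g (u i)) (comm g (u i)))"
proof -
  \<comment> \<open>\<open>a\<close> absorbs the factor \<open>d\<close> of
    \<open>inner_comm\<close>; the extra \<open>d\<close> on the left of the claim completes the
    square \<open>(a i j)^2\<close> there.\<close>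
  define a where "a i j = d * inner_on V (\<lambda>x. g x * u i x) (u j)" for i j
  have sym: "a i j = a j i" for i j
    unfolding a_def inner_on_def by (simp add: ac_simps)
  have 1: "d * inner_on V (comm g (u i)) (\<lambda>x. g x * u i x) = (\<Sum>j<card V. (lam j - lam i) * (a i j)^2)"
    if "i < card V" for i
    by (subst orthonormal_parseval[OF finV on], assumption+, unfold sum_distrib_left, intro sum.cong refl)
      (simp add: inner_comm[OF eig[OF that] eig] a_def power2_eq_square algebra_simps)
  have 2: "inner_on V (comm g (u i)) (comm g (u i)) = (\<Sum>j<card V. (lam j - lam i)^2 * (a i j)^2)"
    if "i < card V" for i
    by (subst orthonormal_parseval[OF finV on], assumption+, intro sum.cong refl)
      (simp add: inner_comm[OF eig[OF that] eig] a_def power2_eq_square algebra_simps)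
  show ?thesis
    using commutator_sum_inequality[of a "card V" lam k, OF sym mono k] k by (simp add: 1 2)
qed

end

section \<open>The finite group of automorphisms\<close>

text \<open>\<open>permutes\<close> fixes all points outside \<open>V\<close>, so that there are
  only finitely many automorphisms even over an infinite type.\<close>

definition automorphisms :: "'a set \<Rightarrow> ('a \<times> 'a) set \<Rightarrow> ('a \<Rightarrow> 'a) set" where
  "automorphisms V E = {\<gamma>. \<gamma> permutes V \<and> (\<forall>x\<in>V. \<forall>y\<in>V. (x, y) \<in> E \<longleftrightarrow> (\<gamma> x, \<gamma> y) \<in> E)}"

lemma automorphisms_compose:
  assumes "\<gamma> \<in> automorphisms V E" "\<delta> \<in> automorphisms V E"
  shows "\<gamma> \<circ> \<delta> \<in> automorphisms V E"
proof -
  have "\<delta> x \<in> V" if "x \<in> V" for x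
    using assms(2) that permutes_in_image[of \<delta> V x] by (auto simp: automorphisms_def)
  then show ?thesis using assms by (auto simp: automorphisms_def intro: permutes_compose)
qed

lemma finite_automorphisms: "finite V \<Longrightarrow> finite (automorphisms V E)"
  by (rule finite_subset[OF _ finite_permutations]) (auto simp: automorphisms_def)

text \<open>Right translation by \<delta> is injective because \<delta> is surjective, and an
  injective self-map of a finite set is onto.\<close>

lemma sum_automorphisms_shift:
  assumes "finite V" and \<delta>: "\<delta> \<in> automorphisms V E"
  shows "(\<Sum>\<gamma>\<in>automorphisms V E. f (\<gamma> \<circ> \<delta>)) = (\<Sum>\<gamma>\<in>automorphisms V E. f \<gamma>)"
proof -
  have "surj \<delta>" using \<delta> permutes_surj[of \<delta> V] by (simp add: automorphisms_def)
  then have inj: "inj_on (\<lambda>\<gamma>. \<gamma> \<circ> \<delta>) (automorphisms V E)"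
    by (intro inj_onI) (auto simp: fun_eq_iff surj_def, metis)
  have "(\<lambda>\<gamma>. \<gamma> \<circ> \<delta>) ` automorphisms V E = automorphisms V E"
    using automorphisms_compose[OF _ \<delta>] inj finite_automorphisms[OF assms(1)]
    by (intro endo_inj_surj) auto
  then show ?thesis using sum.reindex[OF inj, of f] by simp
qed

section \<open>Sums over automorphisms of an arc-transitive graph\<close>

locale symmetric_relation = regular_relation +
  assumes arc_trans: "(x, y) \<in> E \<Longrightarrow> (x', y') \<in> E \<Longrightarrow>
    \<exists>\<gamma>\<in>automorphisms V E. \<gamma> x = x' \<and> \<gamma> y = y'"
begin

abbreviation Aut :: "('a \<Rightarrow> 'a) set" where "Aut \<equiv> automorphisms V E"

lemma finite_Aut: "finite Aut" by (rule finite_automorphisms[OF finV])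

lemma Aut_in: "\<gamma> \<in> Aut \<Longrightarrow> \<gamma> x \<in> V \<longleftrightarrow> x \<in> V"
  by (auto simp: automorphisms_def permutes_in_image)

lemma Aut_nb:
  assumes "\<gamma> \<in> Aut" "x \<in> V"
  shows "bij_betw \<gamma> (nb x) (nb (\<gamma> x))"
  unfolding bij_betw_def
proof
  have p: "\<gamma> permutes V" and e: "\<And>x y. x \<in> V \<Longrightarrow> y \<in> V \<Longrightarrow> (x, y) \<in> E \<longleftrightarrow> (\<gamma> x, \<gamma> y) \<in> E"
    using assms(1) by (auto simp: automorphisms_def)
  show "inj_on \<gamma> (nb x)" using permutes_inj[OF p] by (rule inj_on_subset) auto
  show "\<gamma> ` nb x = nb (\<gamma> x)"
  proof
    show "\<gamma> ` nb x \<subseteq> nb (\<gamma> x)" using e assms(2) nb_subset by auto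
    show "nb (\<gamma> x) \<subseteq> \<gamma> ` nb x"
    proof
      fix z assume z: "z \<in> nb (\<gamma> x)"
      then have "z \<in> \<gamma> ` V" using nb_subset permutes_image[OF p] by auto
      then show "z \<in> \<gamma> ` nb x" using z e[OF assms(2)] by auto
    qed
  qed
qed

lemma eigf_compose:
  assumes h: "eigf \<mu> h" and g: "\<gamma> \<in> Aut"
  shows "eigf \<mu> (h \<circ> \<gamma>)"
  unfolding eigf_def
proof
  fix x assume x: "x \<in> V"
  have "(\<Sum>y\<in>nb x. (h \<circ> \<gamma>) y) = (\<Sum>y\<in>nb (\<gamma> x). h y)"
    using sum.reindex_bij_betw[OF Aut_nb[OF g x], of h] by simp
  then show "(\<Sum>y\<in>nb x. (h \<circ> \<gamma>) y) = d * (1 - \<mu>) * (h \<circ> \<gamma>) x"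
    using eigfD[OF h, of "\<gamma> x"] Aut_in[OF g] x by simp
qed

lemma ex_nb: "x \<in> V \<Longrightarrow> \<exists>y. (x, y) \<in> E"
  using deg[of x] dpos by (cases "nb x = {}") auto

text \<open>The average of \<open>h \<otimes> h\<close> over the group, left unnormalised because
  its diagonal value cancels in the end.\<close>

definition aut_kernel :: "('a \<Rightarrow> real) \<Rightarrow> 'a \<Rightarrow> 'a \<Rightarrow> real" where
  "aut_kernel h x y = (\<Sum>\<gamma>\<in>Aut. h (\<gamma> x) * h (\<gamma> y))"

lemma aut_kernel_invariant:
  assumes "\<delta> \<in> Aut"
  shows "aut_kernel h (\<delta> x) (\<delta> y) = aut_kernel h x y"
  using sum_automorphisms_shift[OF finV assms, of "\<lambda>\<gamma>. h (\<gamma> x) * h (\<gamma> y)"]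
  unfolding aut_kernel_def by simp

text \<open>Every vertex starts an arc, so arc-transitivity implies vertex-transitivity.\<close>

lemma aut_kernel_diag:
  assumes "x \<in> V" "x' \<in> V"
  shows "aut_kernel h x x = aut_kernel h x' x'"
proof -
  obtain \<delta> where "\<delta> \<in> Aut" "\<delta> x = x'"
    using arc_trans ex_nb[OF assms(1)] ex_nb[OF assms(2)] by blast
  then show ?thesis using aut_kernel_invariant[of \<delta> h x x] by simp
qed

lemma aut_kernel_arc:
  assumes h: "eigf \<mu> h" and xy: "(x, y) \<in> E"
  shows "aut_kernel h x y = (1 - \<mu>) * aut_kernel h x x"
proof -
  have x: "x \<in> V" using xy arcs by auto
  \<comment> \<open>Arc-transitivity for two arcs starting at \<open>x\<close> makes the stabiliser
    of \<open>x\<close> transitive on its neighbours.\<close>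
  have "aut_kernel h x y' = aut_kernel h x y" if "y' \<in> nb x" for y'
  proof -
    obtain \<delta> where "\<delta> \<in> Aut" "\<delta> x = x" "\<delta> y = y'" using arc_trans[OF xy, of x y'] \<open>y' \<in> nb x\<close> by blast
    then show ?thesis using aut_kernel_invariant[of \<delta> h x y] by simp
  qed
  then have "d * aut_kernel h x y = (\<Sum>y'\<in>nb x. aut_kernel h x y')"
    using deg[OF x] by simp
  also have "\<dots> = (\<Sum>\<gamma>\<in>Aut. h (\<gamma> x) * (\<Sum>y'\<in>nb x. (h \<circ> \<gamma>) y'))"
    unfolding aut_kernel_def by (subst sum.swap) (simp add: sum_distrib_left)
  also have "\<dots> = (\<Sum>\<gamma>\<in>Aut. d * (1 - \<mu>) * (h (\<gamma> x) * h (\<gamma> x)))"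
    by (intro sum.cong refl) (subst eigfD[OF eigf_compose[OF h] x], auto)
  also have "\<dots> = d * ((1 - \<mu>) * aut_kernel h x x)"
    unfolding aut_kernel_def by (simp add: sum_distrib_left mult.assoc)
  finally show ?thesis using dpos by simp
qed

text \<open>The side that is evaluated exactly: on every arc
  \<open>aut_kernel h x x - aut_kernel h x y\<close> is the constant \<open>S * \<mu>\<close>, which
  leaves the adjacency form of \<open>u\<close>.\<close>

lemma sum_aut_inner_comm:
  assumes h: "eigf \<mu> h" and u: "eigf \<nu> u" and S: "\<And>x. x \<in> V \<Longrightarrow> aut_kernel h x x = S"
  shows "(\<Sum>\<gamma>\<in>Aut. inner_on V (comm (h \<circ> \<gamma>) u) (\<lambda>x. (h \<circ> \<gamma>) x * u x))
       = d * S * \<mu> * (1 - \<nu>) * inner_on V u u"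
proof -
  have "(\<Sum>\<gamma>\<in>Aut. inner_on V (comm (h \<circ> \<gamma>) u) (\<lambda>x. (h \<circ> \<gamma>) x * u x))
     = (\<Sum>\<gamma>\<in>Aut. \<Sum>x\<in>V. \<Sum>y\<in>nb x. u x * u y * (h (\<gamma> x) * h (\<gamma> x) - h (\<gamma> x) * h (\<gamma> y)))"
    unfolding inner_on_def comm_def sum_distrib_right
    by (intro sum.cong refl) (simp add: algebra_simps)
  also have "\<dots> = (\<Sum>x\<in>V. \<Sum>y\<in>nb x. \<Sum>\<gamma>\<in>Aut. u x * u y * (h (\<gamma> x) * h (\<gamma> x) - h (\<gamma> x) * h (\<gamma> y)))"
    by (subst sum.swap, intro sum.cong refl, rule sum.swap)
  also have "\<dots> = (\<Sum>x\<in>V. \<Sum>y\<in>nb x. u x * u y * (aut_kernel h x x - aut_kernel h x y))"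
    unfolding aut_kernel_def by (simp add: sum_distrib_left[symmetric] sum_subtractf)
  also have "\<dots> = S * \<mu> * (\<Sum>x\<in>V. \<Sum>y\<in>nb x. u x * u y)"
    unfolding sum_distrib_left
    by (intro sum.cong refl) (auto simp: S aut_kernel_arc[OF h] algebra_simps)
  also have "\<dots> = d * S * \<mu> * (1 - \<nu>) * inner_on V u u"
    unfolding sum_arcs_eigf[OF u] by simp
  finally show ?thesis .
qed

text \<open>Writing \<open>u y = u x + (u y - u x)\<close> splits the commutator into a multiple of
  \<open>u x\<close>, known from the eigenvalue equation of \<open>h\<close>, and a remainder
  \<open>W\<close>. Only the square of \<open>W\<close> is estimated; the other two terms are
  exact.\<close>

lemma sum_aut_comm_square_pointwise:
  assumes h: "eigf \<mu> h" and u: "eigf \<nu> u" and S: "\<And>x. x \<in> V \<Longrightarrow> aut_kernel h x x = S"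
    and x: "x \<in> V"
  shows "(\<Sum>\<gamma>\<in>Aut. (comm (h \<circ> \<gamma>) u x)^2)
     \<le> d^2 * S * \<mu>^2 * (1 - 2 * \<nu>) * (u x * u x) + 2 * d * S * \<mu> * (\<Sum>y\<in>nb x. (u y - u x)^2)"
proof -
  define W where "W \<gamma> = (\<Sum>y\<in>nb x. (h (\<gamma> x) - h (\<gamma> y)) * (u y - u x))" for \<gamma>
  define D where "D = (\<Sum>y\<in>nb x. (u y - u x)^2)"
  have arc: "aut_kernel h x y = (1 - \<mu>) * S" if "y \<in> nb x" for y
    using aut_kernel_arc[OF h, of x y] S[OF x] that by simp
  have comm_eq: "comm (h \<circ> \<gamma>) u x = d * \<mu> * h (\<gamma> x) * u x + W \<gamma>" if g: "\<gamma> \<in> Aut" for \<gamma>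
  proof -
    have "comm (h \<circ> \<gamma>) u x = (\<Sum>y\<in>nb x. h (\<gamma> x) - (h \<circ> \<gamma>) y) * u x + W \<gamma>"
      unfolding comm_def W_def sum_distrib_right sum.distrib[symmetric]
      by (intro sum.cong refl) (simp add: algebra_simps)
    also have "(\<Sum>y\<in>nb x. h (\<gamma> x) - (h \<circ> \<gamma>) y) = d * \<mu> * h (\<gamma> x)"
      unfolding sum_subtractf eigfD[OF eigf_compose[OF h g] x]
      using deg[OF x] by (simp add: algebra_simps)
    finally show ?thesis .
  qed
  have cross: "(\<Sum>\<gamma>\<in>Aut. h (\<gamma> x) * W \<gamma>) = - (d * \<nu> * \<mu> * S * u x)"
  proof -
    have "(\<Sum>\<gamma>\<in>Aut. h (\<gamma> x) * W \<gamma>)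
        = (\<Sum>y\<in>nb x. \<Sum>\<gamma>\<in>Aut. (u y - u x) * (h (\<gamma> x) * h (\<gamma> x) - h (\<gamma> x) * h (\<gamma> y)))"
      unfolding W_def sum_distrib_left
      by (subst sum.swap, intro sum.cong refl) (simp add: algebra_simps)
    also have "\<dots> = (\<Sum>y\<in>nb x. (u y - u x) * (aut_kernel h x x - aut_kernel h x y))"
      unfolding aut_kernel_def by (simp add: sum_distrib_left[symmetric] sum_subtractf)
    also have "\<dots> = (\<Sum>y\<in>nb x. (u y - u x) * (\<mu> * S))"
      by (intro sum.cong refl) (simp add: S[OF x] arc algebra_simps)
    also have "\<dots> = ((\<Sum>y\<in>nb x. u y) - d * u x) * (\<mu> * S)"
      using deg[OF x] by (simp add: sum_distrib_right[symmetric] sum_subtractf)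
    finally show ?thesis unfolding eigfD[OF u x] by (simp add: algebra_simps)
  qed
  have W2: "(\<Sum>\<gamma>\<in>Aut. (W \<gamma>)^2) \<le> 2 * d * S * \<mu> * D"
  proof -
    \<comment> \<open>Cauchy-Schwarz over the neighbours for each \<gamma> separately; the sum over
      \<gamma> then gives \<open>2 * S * \<mu>\<close> for each of the \<open>d\<close> arcs at
      \<open>x\<close>.\<close>
    have "(\<Sum>\<gamma>\<in>Aut. (W \<gamma>)^2) \<le> (\<Sum>\<gamma>\<in>Aut. (\<Sum>y\<in>nb x. (h (\<gamma> x) - h (\<gamma> y))^2) * D)"
      unfolding W_def D_def by (intro sum_mono Cauchy_Schwarz_ineq_sum)
    also have "\<dots> = (\<Sum>y\<in>nb x. \<Sum>\<gamma>\<in>Aut. (h (\<gamma> x) - h (\<gamma> y))^2) * D"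
      unfolding sum_distrib_right[symmetric] by (subst sum.swap) simp
    also have "(\<Sum>y\<in>nb x. \<Sum>\<gamma>\<in>Aut. (h (\<gamma> x) - h (\<gamma> y))^2)
       = (\<Sum>y\<in>nb x. aut_kernel h x x + aut_kernel h y y - 2 * aut_kernel h x y)"
      unfolding aut_kernel_def sum_distrib_left sum.distrib[symmetric] sum_subtractf[symmetric]
      by (intro sum.cong refl) (simp add: algebra_simps power2_eq_square)
    also have "\<dots> = (\<Sum>y\<in>nb x. 2 * S * \<mu>)"
    proof (intro sum.cong refl)
      fix y assume y: "y \<in> nb x"
      then have "y \<in> V" using nb_subset by blast
      then show "aut_kernel h x x + aut_kernel h y y - 2 * aut_kernel h x y = 2 * S * \<mu>"
        by (simp add: S x arc[OF y] algebra_simps)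
    qed
    finally show ?thesis using deg[OF x] by (simp add: algebra_simps)
  qed
  have "(\<Sum>\<gamma>\<in>Aut. (comm (h \<circ> \<gamma>) u x)^2)
      = (\<Sum>\<gamma>\<in>Aut. d^2 * \<mu>^2 * (u x * u x) * (h (\<gamma> x) * h (\<gamma> x))
           + 2 * d * \<mu> * u x * (h (\<gamma> x) * W \<gamma>) + (W \<gamma>)^2)"
    by (intro sum.cong refl) (simp add: comm_eq power2_eq_square algebra_simps)
  also have "\<dots> = d^2 * \<mu>^2 * (u x * u x) * S + 2 * d * \<mu> * u x * (- (d * \<nu> * \<mu> * S * u x)) + (\<Sum>\<gamma>\<in>Aut. (W \<gamma>)^2)"
    unfolding sum.distrib sum_distrib_left[symmetric] cross S[OF x, symmetric] aut_kernel_def ..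
  also have "\<dots> = d^2 * S * \<mu>^2 * (1 - 2 * \<nu>) * (u x * u x) + (\<Sum>\<gamma>\<in>Aut. (W \<gamma>)^2)"
    by (simp add: algebra_simps power2_eq_square)
  finally show ?thesis using W2 unfolding D_def by simp
qed

lemma sum_aut_norm_comm:
  assumes h: "eigf \<mu> h" and u: "eigf \<nu> u" and S: "\<And>x. x \<in> V \<Longrightarrow> aut_kernel h x x = S"
  shows "(\<Sum>\<gamma>\<in>Aut. inner_on V (comm (h \<circ> \<gamma>) u) (comm (h \<circ> \<gamma>) u))
       \<le> d^2 * S * \<mu> * (2 * (2 - \<mu>) * \<nu> + \<mu>) * inner_on V u u"
proof -
  have "(\<Sum>\<gamma>\<in>Aut. inner_on V (comm (h \<circ> \<gamma>) u) (comm (h \<circ> \<gamma>) u))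
      = (\<Sum>x\<in>V. \<Sum>\<gamma>\<in>Aut. (comm (h \<circ> \<gamma>) u x)^2)"
    unfolding inner_on_def power2_eq_square by (rule sum.swap)
  also have "\<dots> \<le> (\<Sum>x\<in>V. d^2 * S * \<mu>^2 * (1 - 2 * \<nu>) * (u x * u x) + 2 * d * S * \<mu> * (\<Sum>y\<in>nb x. (u y - u x)^2))"
    by (intro sum_mono sum_aut_comm_square_pointwise[OF h u S])
  also have "\<dots> = d^2 * S * \<mu>^2 * (1 - 2 * \<nu>) * inner_on V u u + 2 * d * S * \<mu> * (2 * d * \<nu> * inner_on V u u)"
    unfolding sum.distrib sum_distrib_left[symmetric] dirichlet_energy[OF u] inner_on_def ..
  \<comment> \<open>Here \<open>\<mu> * (1 - 2 * \<nu>) + 4 * \<nu> = 2 * (2 - \<mu>) * \<nu> +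
    \<mu>\<close>.\<close>
  also have "\<dots> = d^2 * S * \<mu> * (2 * (2 - \<mu>) * \<nu> + \<mu>) * inner_on V u u"
    by (simp add: algebra_simps power2_eq_square)
  finally show ?thesis .
qed

text \<open>Summing \<open>commutator_inequality\<close> for \<open>h \<circ> \<gamma>\<close> over
  all \<gamma> produces the common factor \<open>d^2 * S * \<mu>\<close>, which is positive and
  cancels.\<close>

lemma yang_type_inequality:
  fixes u :: "nat \<Rightarrow> 'a \<Rightarrow> real"
  assumes mono: "mono_on {..<card V} lam" and k: "k + 1 < card V"
    and eig: "\<And>i. i < card V \<Longrightarrow> eigf (lam i) (u i)"
    and on: "\<And>i j. i < card V \<Longrightarrow> j < card V \<Longrightarrow> inner_on V (u i) (u j) = (if i = j then 1 else 0)"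
    and h: "eigf \<mu> h" and hx: "x0 \<in> V" "h x0 \<noteq> 0" and "\<mu> \<noteq> 0"
  shows "(\<Sum>i=0..k. (lam (k + 1) - lam i)^2 * (1 - lam i))
         \<le> (\<Sum>i=0..k. (lam (k + 1) - lam i) * (2 * (2 - \<mu>) * lam i + \<mu>))"
proof -
  define S where "S = aut_kernel h x0 x0"
  have S: "aut_kernel h x x = S" if "x \<in> V" for x
    unfolding S_def by (rule aut_kernel_diag[OF that hx(1)])
  \<comment> \<open>The identity contributes \<open>h x0 * h x0 > 0\<close> to \<open>S\<close>, and
    all other terms are non-negative.\<close>
  have "id \<in> Aut" by (simp add: automorphisms_def permutes_id)
  then have "S > 0"
    unfolding S_def aut_kernel_def using hx finite_Aut
    by (intro sum_pos2[of _ id]) (auto simp: zero_less_mult_iff linorder_neq_iff)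
  moreover have "\<mu> > 0" using eigenvalue_nonneg[OF h hx] \<open>\<mu> \<noteq> 0\<close> by simp
  ultimately have pos: "d^2 * S * \<mu> > 0" using dpos by simp
  define c where "c i = lam (k + 1) - lam i" for i
  have "(d^2 * S * \<mu>) * (\<Sum>i=0..k. (c i)^2 * (1 - lam i))
      = (\<Sum>i=0..k. (c i)^2 * (d * (d * S * \<mu> * (1 - lam i) * inner_on V (u i) (u i))))"
    unfolding sum_distrib_left using k
    by (intro sum.cong refl) (simp add: on power2_eq_square algebra_simps)
  also have "\<dots> = (\<Sum>i=0..k. (c i)^2 * (d * (\<Sum>\<gamma>\<in>Aut. inner_on V (comm (h \<circ> \<gamma>) (u i)) (\<lambda>x. (h \<circ> \<gamma>) x * u i x))))"
    using k by (intro sum.cong refl) (subst sum_aut_inner_comm[OF h eig S], auto)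
  also have "\<dots> = (\<Sum>\<gamma>\<in>Aut. \<Sum>i=0..k. (c i)^2 * (d * inner_on V (comm (h \<circ> \<gamma>) (u i)) (\<lambda>x. (h \<circ> \<gamma>) x * u i x)))"
    unfolding sum_distrib_left by (rule sum.swap)
  also have "\<dots> \<le> (\<Sum>\<gamma>\<in>Aut. \<Sum>i=0..k. c i * inner_on V (comm (h \<circ> \<gamma>) (u i)) (comm (h \<circ> \<gamma>) (u i)))"
    unfolding c_def by (intro sum_mono commutator_inequality[OF mono k eig on])
  also have "\<dots> = (\<Sum>i=0..k. c i * (\<Sum>\<gamma>\<in>Aut. inner_on V (comm (h \<circ> \<gamma>) (u i)) (comm (h \<circ> \<gamma>) (u i))))"
    unfolding sum_distrib_left by (rule sum.swap)
  also have "\<dots> \<le> (\<Sum>i=0..k. c i * (d^2 * S * \<mu> * (2 * (2 - \<mu>) * lam i + \<mu>) * inner_on V (u i) (u i)))"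
  proof (intro sum_mono mult_left_mono sum_aut_norm_comm[OF h eig S])
    fix i assume "i \<in> {0..k}"
    then show "i < card V" "0 \<le> c i"
      using k unfolding c_def by (auto intro!: mono_onD[OF mono])
  qed
  also have "\<dots> = (d^2 * S * \<mu>) * (\<Sum>i=0..k. c i * (2 * (2 - \<mu>) * lam i + \<mu>))"
    unfolding sum_distrib_left using k
    by (intro sum.cong refl) (simp add: on algebra_simps)
  finally show ?thesis unfolding mult_le_cancel_left_pos[OF pos] c_def .
qed

text \<open>The multiplicities supply, for each value \<nu>, an orthonormal set
  \<open>B \<nu>\<close> with as many elements as there are indices \<open>i\<close> with
  \<open>lam i = \<nu>\<close>. Matching indices with elements gives \<open>card V\<close>
  eigenfunctions, orthogonal across different eigenvalues by \<open>eigf_orthogonal\<close>.\<close>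

lemma yang_type_inequality_of_spectrum:
  assumes mono: "mono_on {..<card V} lam" and k: "k + 1 < card V"
    and mult: "\<And>\<nu>. card {i. i < card V \<and> lam i = \<nu>} = fun_space.dim (supported_eigf \<nu>)"
    and h: "h \<in> supported_eigf \<mu>" "h \<noteq> 0" and "\<mu> \<noteq> 0"
  shows "(\<Sum>i=0..k. (lam (k + 1) - lam i)^2 * (1 - lam i))
         \<le> (\<Sum>i=0..k. (lam (k + 1) - lam i) * (2 * (2 - \<mu>) * lam i + \<mu>))"
proof -
  have "\<exists>B\<subseteq>supported_eigf \<nu>. finite B \<and> card B = card {i. i < card V \<and> lam i = \<nu>} \<and>
      (\<forall>b\<in>B. \<forall>c\<in>B. inner_on V b c = (if b = c then 1 else 0))" for \<nu>
    by (rule orthonormal_set_in_subspace[OF finV subspace_supported_eigf])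
      (auto simp: supported_eigf_def mult)
  then obtain B where B: "B \<nu> \<subseteq> supported_eigf \<nu>" "finite (B \<nu>)"
      "card (B \<nu>) = card {i. i < card V \<and> lam i = \<nu>}"
      "\<forall>b\<in>B \<nu>. \<forall>c\<in>B \<nu>. inner_on V b c = (if b = c then 1 else 0)" for \<nu>
    by metis
  have "\<exists>f. bij_betw f {i. i < card V \<and> lam i = \<nu>} (B \<nu>)" for \<nu>
    using B(2,3) by (intro finite_same_card_bij) auto
  then obtain f where f: "bij_betw (f \<nu>) {i. i < card V \<and> lam i = \<nu>} (B \<nu>)" for \<nu>
    by metis
  define u where "u i = f (lam i) i" for i
  have uB: "u i \<in> B (lam i)" if "i < card V" for i
    unfolding u_def using bij_betwE[OF f[of "lam i"]] that by blast
  have eig: "eigf (lam i) (u i)" if "i < card V" for i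
    using uB[OF that] B(1) by (auto simp: supported_eigf_def)
  have on: "inner_on V (u i) (u j) = (if i = j then 1 else 0)"
    if i: "i < card V" and j: "j < card V" for i j
  proof (cases "lam i = lam j")
    case True
    have "u i = u j \<longleftrightarrow> i = j"
      unfolding u_def True using bij_betw_imp_inj_on[OF f[of "lam j"]] True i j
      by (auto dest: inj_onD)
    then show ?thesis using B(4) uB[OF i] uB[OF j] True by auto
  next
    case False
    then show ?thesis using eigf_orthogonal[OF eig[OF i] eig[OF j]] by auto
  qed
  obtain x where "h x \<noteq> 0" using h(2) by (auto simp: fun_eq_iff)
  moreover have "x \<in> V" "eigf \<mu> h"
    using h(1) \<open>h x \<noteq> 0\<close> unfolding supported_eigf_def by auto
  ultimately show ?thesis
    using yang_type_inequality[OF mono k eig on] \<open>\<mu> \<noteq> 0\<close> by blast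
qed

end

section \<open>Passage from \<open>pair_graph\<close> to the relational setting\<close>

lemma connected_ex_arc:
  assumes "pair_graph G" and conn: "Digraph_Component.connected (with_proj G)"
    and "card (pverts G) \<ge> 2" and x: "x \<in> pverts G"
  shows "\<exists>y. (x, y) \<in> parcs G"
proof -
  interpret pair_graph G by fact
  have "\<not> pverts G \<subseteq> {x}"
    using assms(3) card_mono[of "{x}" "pverts G"] by auto
  then obtain y where y: "y \<in> pverts G" "y \<noteq> x" by auto
  have "(x, y) \<in> rtrancl_on (pverts G) (parcs (mk_symmetric (with_proj G)))"
    using conn x y unfolding connected_def strongly_connected_def reachable_def
    by (simp add: mk_symmetric_def)
  \<comment> \<open>The first step of a path from \<open>x\<close> to \<open>y \<noteq> x\<close>.
    It lies in the symmetrised graph, hence is an arc of \<open>G\<close> in one direction and, by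
    symmetry, in both.\<close>
  then obtain c where "(x, c) \<in> parcs (mk_symmetric (with_proj G))"
    using y by (cases rule: converse_rtrancl_on_cases) auto
  then have "(x, c) \<in> parcs G \<or> (c, x) \<in> parcs G" by (auto simp: mk_symmetric_def)
  moreover have "sym (parcs G)" using pair_sym_arcs by (simp add: symmetric_def)
  ultimately show ?thesis by (auto dest: symD)
qed

text \<open>\<open>graph_automorphism\<close> leaves the values outside the vertex set free;
  resetting them to the identity yields a permutation in the sense of
  \<open>permutes\<close>.\<close>

lemma arc_transitive_automorphism:
  assumes "pair_graph G" "arc_transitive G" "(x, y) \<in> parcs G" "(x', y') \<in> parcs G"
  shows "\<exists>\<gamma>\<in>automorphisms (pverts G) (parcs G). \<gamma> x = x' \<and> \<gamma> y = y'"
proof -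
  interpret pair_graph G by fact
  have V: "x \<in> pverts G" "y \<in> pverts G"
    using arc_fst_in_verts[OF assms(3)] arc_snd_in_verts[OF assms(3)] by auto
  obtain \<gamma> where \<gamma>: "graph_automorphism G \<gamma>" "\<gamma> x = x'" "\<gamma> y = y'"
    using assms unfolding arc_transitive_def by blast
  define \<delta> where "\<delta> z = (if z \<in> pverts G then \<gamma> z else z)" for z
  have "bij_betw \<delta> (pverts G) (pverts G)"
    using \<gamma>(1) unfolding graph_automorphism_def \<delta>_def
    by (auto intro: bij_betw_cong[THEN iffD1])
  then have "\<delta> permutes pverts G"
    by (rule bij_imp_permutes) (simp add: \<delta>_def)
  then have "\<delta> \<in> automorphisms (pverts G) (parcs G)"
    using \<gamma>(1) unfolding automorphisms_def graph_automorphism_def by (auto simp: \<delta>_def)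
  then show ?thesis using \<gamma> V by (intro bexI[of _ \<delta>]) (auto simp: \<delta>_def)
qed

lemma out_degree_with_proj: "out_degree (with_proj G) x = card {y. (x, y) \<in> parcs G}"
proof -
  have "out_arcs (with_proj G) x = Pair x ` {y. (x, y) \<in> parcs G}"
    by (auto simp: out_arcs_def)
  then show ?thesis by (simp add: out_degree_def card_image inj_on_def)
qed

text \<open>An automorphism embeds the neighbours of \<open>x\<close> into those of its image.
  Equality of degrees follows later by exchanging the two vertices.\<close>

lemma out_degree_le_of_automorphism:
  assumes "pair_graph G" "\<gamma> \<in> automorphisms (pverts G) (parcs G)" "x \<in> pverts G"
  shows "out_degree (with_proj G) x \<le> out_degree (with_proj G) (\<gamma> x)"
  unfolding out_degree_with_proj
proof (rule card_inj_on_le[of \<gamma>])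
  interpret pair_graph G by fact
  have arcs: "parcs G \<subseteq> pverts G \<times> pverts G"
    using arc_fst_in_verts arc_snd_in_verts by force
  have "\<gamma> permutes pverts G" using assms(2) by (simp add: automorphisms_def)
  then show "inj_on \<gamma> {y. (x, y) \<in> parcs G}"
    using permutes_inj inj_on_subset by blast
  show "\<gamma> ` {y. (x, y) \<in> parcs G} \<subseteq> {y. (\<gamma> x, y) \<in> parcs G}"
    using assms(2,3) arcs by (auto simp: automorphisms_def)
  show "finite {y. (\<gamma> x, y) \<in> parcs G}"
    by (rule finite_subset[OF _ pair_finite_verts]) (use arcs in auto)
qed

theorem theorem1p1:
  fixes G :: "'v pair_pre_digraph"
    and lam :: "nat \<Rightarrow> real" and \<mu> :: real and k :: nat
  assumes "pair_graph G"
    and "Digraph_Component.connected (with_proj G)"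
    and "card (pverts G) \<ge> 2"
    and "arc_transitive G"
    and "laplace_spectrum G lam"
    and "is_eigenvalue G \<mu>" and "\<mu> \<noteq> 0"
    and "k \<le> card (pverts G) - 2"
  shows "(\<Sum>i=0..k. (lam (k + 1) - lam i)^2 * (1 - lam i))
         \<le> (\<Sum>i=0..k. (lam (k + 1) - lam i) * (2 * (2 - \<mu>) * lam i + \<mu>))"
proof -
  interpret pair_graph G by fact
  let ?V = "pverts G" and ?deg = "out_degree (with_proj G)"
  note ex_arc = connected_ex_arc[OF assms(1-3)]
  note trans = arc_transitive_automorphism[OF assms(1,4)]
  obtain v0 where v0: "v0 \<in> ?V" using assms(3) by fastforce
  have deg_le: "?deg x \<le> ?deg x'" if x: "x \<in> ?V" and x': "x' \<in> ?V" for x x'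
  proof -
    obtain y y' where "(x, y) \<in> parcs G" "(x', y') \<in> parcs G"
      using ex_arc[OF x] ex_arc[OF x'] by blast
    from trans[OF this] obtain \<gamma> where "\<gamma> \<in> automorphisms ?V (parcs G)" "\<gamma> x = x'"
      by blast
    then show ?thesis using out_degree_le_of_automorphism[OF assms(1) _ x] by blast
  qed
  define d where "d = real (?deg v0)"
  have deg: "real (?deg x) = d" if "x \<in> ?V" for x
    unfolding d_def using deg_le[OF that v0] deg_le[OF v0 that] by simp
  have arcs: "parcs G \<subseteq> ?V \<times> ?V"
    using arc_fst_in_verts arc_snd_in_verts by force
  have sr: "symmetric_relation ?V (parcs G) d"
  proof
    show "finite ?V" by (rule pair_finite_verts)
    show "parcs G \<subseteq> ?V \<times> ?V" by (rule arcs)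
    show "(y, x) \<in> parcs G" if "(x, y) \<in> parcs G" for x y
      using pair_sym_arcs that by (auto simp: symmetric_def dest: symD)
    show "real (card {y. (x, y) \<in> parcs G}) = d" if "x \<in> ?V" for x
      using deg[OF that] by (simp add: out_degree_with_proj)
    have "finite {y. (v0, y) \<in> parcs G}"
      by (rule finite_subset[OF _ pair_finite_verts]) (use arcs in auto)
    then show "d > 0"
      using ex_arc[OF v0] by (auto simp: d_def out_degree_with_proj card_gt_0_iff)
  qed (rule trans)
  have "d > 0" and reg: "regular_relation ?V (parcs G) d"
    using sr by (auto simp: symmetric_relation_def regular_relation_def)
  \<comment> \<open>Multiplication by the positive degree \<open>d\<close> identifies the Laplace
    equation with \<open>eigf\<close>.\<close>
  have "laplacian G u x + \<nu> * u x = 0 \<longleftrightarrow> (\<Sum>y | (x, y) \<in> parcs G. u y) = d * (1 - \<nu>) * u x"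
    if "x \<in> ?V" for u \<nu> x
    unfolding laplacian_def deg[OF that] using deg[OF that] \<open>d > 0\<close>
    by (simp add: sum_subtractf out_degree_with_proj field_simps)
  then have eigenspace: "eigenspace G \<nu> = regular_relation.supported_eigf ?V (parcs G) d \<nu>" for \<nu>
    unfolding eigenspace_def regular_relation.supported_eigf_def[OF reg] regular_relation.eigf_def[OF reg]
    by blast
  obtain h where "h \<in> eigenspace G \<mu>" "h \<noteq> 0"
    using assms(6) unfolding is_eigenvalue_def by blast
  \<comment> \<open>At least two vertices: the natural-number difference
    \<open>card (pverts G) - 2\<close> is not truncated.\<close>
  moreover have "k + 1 < card ?V" using assms(3,8) by simp
  ultimately show ?thesis
    using assms(5,7) unfolding laplace_spectrum_def multiplicity_of_def eigenspace
    by (intro symmetric_relation.yang_type_inequality_of_spectrum[OF sr, where h = h]) auto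
qed

end
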